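(* Let $n\ge1$ be an integer. The spectrum of $U_n$, acting on the set $\mathfrak{H}$ of hypergeometric functions, is the set $\{n^i : i\in\mathbb{Z}\}$.
   Context: All series are formal power series over $\mathbb{C}$. The operator $U_n$ acts by $U_n\left(\sum_{k\ge0} c_k x^k\right) = \sum_{k\ge 0} c_{nk}x^k$. The spectrum is the set of its eigenvalues, i.e. of the $\lambda\in\mathbb{C}$ for which $U_nf=\lambda f$ for some non-zero $f\in\mathfrak{H}$. The ascending factorial is $(c)_0=1$, $(c)_k = c(c+1)\cdots(c+k-1)$. The set of hypergeometric functions is $$\mathfrak{H}=\left\{x^j\sum_{k\ge 0}\frac{(a_1)_k\cdots(a_p)_k}{(b_1)_k\cdots(b_q)_k}\frac{x^k}{k!}\;:\; j,p,q\ge0 \text{ integers},\ a_1,\dots,a_p\in\mathbb{C},\ b_1,\dots,b_q\in\mathbb{C}\setminus\{0,-1,-2,\dots\}\right\}.$$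
   Formalization: For n≥2 the function x (j=1, p=1, a_1=0) lies in the set and U_n x=0, so 0 is also an eigenvalue; what is proved is that the spectrum is {n^i} together with 0 when n≥2 ({n^i} when n=1), and exactly {n^i} on the non-terminating hypergeometric functions. *)

theory Defs
  imports "HOL-Computational_Algebra.Formal_Power_Series" "HOL-Library.Nonpos_Ints"
begin

definition hecke_U :: "nat \<Rightarrow> complex fps \<Rightarrow> complex fps" where
  "hecke_U n f = Abs_fps (\<lambda>k. fps_nth f (n * k))"

(* pochhammer, which underlies fps_hypergeo, is the ascending factorial.  The argument of the
   series is fps_X itself, so the scaling parameter of fps_hypergeo is 1. *)
definition hypergeometric_functions :: "complex fps set" where
  "hypergeometric_functions =
     {fps_X ^ j * fps_hypergeo as bs 1 | j as bs. set bs \<inter> \<int>\<^sub>\<le>\<^sub>0 = {}}"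

(* Some numerator parameter may be a non-positive integer, in which case the series terminates;
   this is the subset of those members that do not. *)
definition nonterminating_hypergeometric_functions :: "complex fps set" where
  "nonterminating_hypergeometric_functions =
     {f \<in> hypergeometric_functions. infinite {k. fps_nth f k \<noteq> 0}}"

(* Point spectrum relative to a set S of series.  S need be neither a linear subspace nor
   invariant under T: hypergeometric_functions is not even closed under scalar multiples. *)
definition spectrum_on :: "(complex fps \<Rightarrow> complex fps) \<Rightarrow> complex fps set \<Rightarrow> complex set" where
  "spectrum_on T S = {l. \<exists>f\<in>S. f \<noteq> 0 \<and> T f = fps_const l * f}"

(* With numerator parameter 0 the series is 1, so every monomial fps_X ^ j is hypergeometric.
   Hence 0 is an eigenvalue for n >= 2, although it is not an integer power of n. *)
lemma zero_in_spectrum_hecke_U: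
  assumes "n \<ge> 2"
  shows "0 \<in> spectrum_on (hecke_U n) hypergeometric_functions"
proof -
  have "fps_hypergeo [0] [] (1::complex) = 1"
    by (rule fps_ext) (auto simp: pochhammer_0_left)
  then have "fps_X = fps_X ^ 1 * fps_hypergeo [0] [] (1::complex) \<and> set [] \<inter> \<int>\<^sub>\<le>\<^sub>0 = ({} :: complex set)"
    by simp
  then have "fps_X \<in> hypergeometric_functions"
    unfolding hypergeometric_functions_def by blast
  moreover have "hecke_U n fps_X = 0"
    using assms by (auto simp: hecke_U_def fps_eq_iff)
  ultimately show ?thesis
    unfolding spectrum_on_def by (auto intro!: bexI[of _ fps_X])
qed

end

theory Submission
  imports Defs "HOL-Computational_Algebra.Polynomial"
begin

text \<open>
  For the powers, the series \<open>\<Sum>k\<ge>1. k\<^sup>i x\<^sup>k\<close> is hypergeometric for every integer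
  \<open>i\<close>, because \<open>k + 1 = (2)\<^sub>k / (1)\<^sub>k\<close>, and it is multiplied by \<open>n\<^sup>i\<close> since
  \<open>(n k)\<^sup>i = n\<^sup>i k\<^sup>i\<close>.

  For the converse, \<open>U\<^sub>1\<close> is the identity; so let \<open>n \<ge> 2\<close> and let \<open>f = x\<^sup>j h\<close> be an eigenfunction for
  \<open>l \<noteq> 0\<close>, so that its coefficients satisfy \<open>c (n k) = l c k\<close>. If \<open>j = 0\<close>, then
  \<open>c 0 = 1\<close> and \<open>l = 1\<close>. If \<open>j > 0\<close>, then \<open>c (n\<^sup>t j) = l\<^sup>t \<noteq> 0\<close> for all
  \<open>t\<close>, so \<open>h\<close> does not terminate and has no vanishing coefficient; now
  \<open>c (n\<^sup>t) = l\<^sup>t c 1\<close> for large \<open>t\<close> forces \<open>c 1 \<noteq> 0\<close>, that is \<open>j = 1\<close>.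

  In this last case \<open>c (k + 1) / c k = R k\<close> for a rational function
  \<open>R x = (\<Prod>a\<in>A. x - a) / (\<Prod>b\<in>B. x - b)\<close>, and the eigenvalue equation becomes
  \<open>R (n x) R (n x + 1) \<cdots> R (n x + n - 1) = R x\<close>. Consider the order \<open>M z\<close> of the pole at \<open>z\<close>
  of the solution \<open>G x = (\<Prod>a\<in>A. Gamma (x - a)) / (\<Prod>b\<in>B. Gamma (x - b))\<close> of
  \<open>G (x + 1) = R x G x\<close>; it is defined below as a plain count, called the excess, so that no
  analysis is involved. The functional equation of \<open>R\<close> says that \<open>M (n z) - M z\<close> has
  period 1, and it vanishes far to the right, so \<open>M (n z) = M z\<close>
  (\<open>excess_scale\<close>). Hence a pole or zero \<open>z \<noteq> 0\<close> would bring along all the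
  \<open>z / n\<^sup>t\<close>, which accumulate at 0, whereas the poles and zeros of \<open>G\<close> are discrete
  (\<open>excess_zero_away_from_0\<close>). So \<open>M\<close> is concentrated at 0, and with \<open>i = M 0\<close> this
  means \<open>R x = (x / (x + 1))\<^sup>i\<close>, whence \<open>c k = c 1 k\<^sup>-\<^sup>i\<close> and
  \<open>l = n\<^sup>-\<^sup>i\<close> (\<open>eigenvalue_of_rational_ratio\<close>).

  Finally, \<open>l = 0\<close> would make the coefficients at all multiples of \<open>n\<close> vanish, and a
  coefficient of a hypergeometric series that vanishes makes all later ones vanish; so 0 occurs
  only for terminating series. It does occur for \<open>n \<ge> 2\<close>, with eigenfunction \<open>x\<close>.
\<close>

unbundle fps_syntax

section \<open>Monic polynomials with prescribed roots\<close>

definition linear_factors :: "complex multiset \<Rightarrow> complex poly" where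
  "linear_factors A = (\<Prod>a\<in>#A. [:-a, 1:])"

lemma linear_factors_empty [simp]: "linear_factors {#} = 1"
  by (simp add: linear_factors_def)

lemma linear_factors_add_mset: "linear_factors (add_mset a A) = [:-a, 1:] * linear_factors A"
  by (simp add: linear_factors_def del: mult_pCons_left)

lemma linear_factors_nonzero [simp]: "linear_factors A \<noteq> 0"
  by (induction A) (simp_all add: linear_factors_add_mset del: mult_pCons_left)

lemma poly_linear_factors: "poly (linear_factors A) x = (\<Prod>a\<in>#A. x - a)"
  by (simp add: linear_factors_def poly_prod_mset)

lemma order_linear_factor_affine:
  fixes d :: complex
  assumes "d \<noteq> 0"
  shows "order z [:e - a, d:] = (if a = d * z + e then 1 else 0)"
proof -
  have eq: "[:e - a, d:] = smult d [:- ((a - e) / d), 1:]"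
    using assms by simp
  have "order z [:e - a, d:] = count (proots [:- ((a - e) / d), 1:]) z"
    unfolding eq order_smult[OF assms] by (rule count_proots[symmetric]) simp
  also have "\<dots> = (if a = d * z + e then 1 else 0)"
    using assms by (subst proots_linear_factor) (auto simp: field_simps)
  finally show ?thesis .
qed

lemma order_linear_factors_affine:
  assumes "d \<noteq> 0"
  shows "pcompose (linear_factors A) [:e, d:] \<noteq> 0"
    and "order z (pcompose (linear_factors A) [:e, d:]) = count A (d * z + e)"
proof -
  have "pcompose (linear_factors A) [:e, d:] \<noteq> 0 \<and>
        order z (pcompose (linear_factors A) [:e, d:]) = count A (d * z + e)"
  proof (induction A)
    case empty
    show ?case by (simp add: pcompose_1)
  next
    case (add a A)
    have "pcompose (linear_factors (add_mset a A)) [:e, d:]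
            = [:e - a, d:] * pcompose (linear_factors A) [:e, d:]"
      unfolding linear_factors_add_mset pcompose_mult by (simp add: pcompose_pCons)
    moreover have "[:e - a, d:] * pcompose (linear_factors A) [:e, d:] \<noteq> 0"
      using add assms by (intro no_zero_divisors) auto
    ultimately show ?case
      using add assms by (simp add: order_mult order_linear_factor_affine del: mult_pCons_left)
  qed
  then show "pcompose (linear_factors A) [:e, d:] \<noteq> 0"
    and "order z (pcompose (linear_factors A) [:e, d:]) = count A (d * z + e)" by auto
qed

lemma order_prod_nonzero:
  fixes p :: "'b \<Rightarrow> 'a::idom poly"
  assumes "finite S" "\<And>i. i \<in> S \<Longrightarrow> p i \<noteq> 0"
  shows "order z (\<Prod>i\<in>S. p i) = (\<Sum>i\<in>S. order z (p i))"
  using assms by (induction S rule: finite_induct) (auto simp: order_mult)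

lemma poly_eq_of_eq_on_positive_nats:
  fixes p q :: "complex poly"
  assumes "\<And>k. k \<ge> 1 \<Longrightarrow> poly p (of_nat k) = poly q (of_nat k)"
  shows "p = q"
proof (rule ccontr)
  assume "p \<noteq> q"
  then have "finite {x. poly (p - q) x = 0}"
    by (intro poly_roots_finite) simp
  moreover have "of_nat ` {1..} \<subseteq> {x. poly (p - q) x = 0}"
    using assms by auto
  ultimately have "finite ((of_nat :: nat \<Rightarrow> complex) ` {1..})"
    by (rule finite_subset[rotated])
  then have "finite {1::nat..}"
    by (rule finite_imageD) (simp add: inj_on_def)
  then show False
    using infinite_Ici by blast
qed

section \<open>The balance of zeros and poles imposed by an eigenvalue equation\<close>

text \<open>The telescoping product of the ratios \<open>c (k + 1) / c k = P k / Q k\<close> for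
  \<open>k = m, \<dots>, m + N - 1\<close>, cleared of denominators.\<close>

lemma telescoping_product:
  fixes c P Q :: "nat \<Rightarrow> complex"
  assumes "\<And>l. l < N \<Longrightarrow> c (Suc (m + l)) * Q (m + l) = P (m + l) * c (m + l)"
  shows "c (m + N) * (\<Prod>l<N. Q (m + l)) = (\<Prod>l<N. P (m + l)) * c m"
  using assms
proof (induction N)
  case (Suc N)
  have "c (m + Suc N) * (\<Prod>l<Suc N. Q (m + l))
          = (c (Suc (m + N)) * Q (m + N)) * (\<Prod>l<N. Q (m + l))"
    by simp
  also have "\<dots> = P (m + N) * (c (m + N) * (\<Prod>l<N. Q (m + l)))"
    using Suc.prems[of N] by simp
  also have "\<dots> = P (m + N) * ((\<Prod>l<N. P (m + l)) * c m)"
    using Suc by simp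
  finally show ?case by simp
qed simp

text \<open>Both \<open>c (k + 1) / c k\<close> and \<open>c (n k + n) / c (n k)\<close> are given by \<open>R = P / Q\<close>, the
  latter as the product of the \<open>R (n k + i)\<close> with \<open>i < n\<close>, and they agree by the eigenvalue
  equation. Agreement at all positive integers is a polynomial identity; the claim compares the
  orders of its two sides at \<open>z\<close>.\<close>

lemma root_multiplicities_balance:
  fixes c :: "nat \<Rightarrow> complex"
  assumes n: "n \<ge> 1"
    and rec: "\<And>k. k \<ge> 1 \<Longrightarrow> c (Suc k) * poly (linear_factors B) (of_nat k)
                       = poly (linear_factors A) (of_nat k) * c k"
    and nz: "\<And>k. k \<ge> 1 \<Longrightarrow> c k \<noteq> 0"
    and eig: "\<And>k. k \<ge> 1 \<Longrightarrow> c (n * k) = l * c k"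
  shows "int (count A z) - int (count B z)
           = (\<Sum>i<n. int (count A (of_nat n * z + of_nat i)) - int (count B (of_nat n * z + of_nat i)))"
proof -
  define P where "P = linear_factors A"
  define Q where "Q = linear_factors B"
  define sec where "sec = (\<lambda>p i. pcompose p [:of_nat i, of_nat n :: complex:])"
  have "l \<noteq> 0"
    using eig[of 1] nz[of 1] nz[of n] n by auto
  have sec_nz: "sec P i \<noteq> 0" "sec Q i \<noteq> 0" for i
    using n by (auto simp: sec_def P_def Q_def order_linear_factors_affine)
  have "P * (\<Prod>i<n. sec Q i) = Q * (\<Prod>i<n. sec P i)"
  proof (rule poly_eq_of_eq_on_positive_nats)
    fix k :: nat
    assume k: "k \<ge> 1"
    let ?p = "\<Prod>i<n. poly P (of_nat (n * k + i))" and ?q = "\<Prod>i<n. poly Q (of_nat (n * k + i))"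
    have "c (n * k + n) * ?q = ?p * c (n * k)"
    proof (rule telescoping_product)
      fix i
      have "n * k + i \<ge> 1" using n k by (simp add: Suc_le_eq)
      from rec[OF this] show "c (Suc (n * k + i)) * poly Q (of_nat (n * k + i))
          = poly P (of_nat (n * k + i)) * c (n * k + i)"
        unfolding P_def Q_def .
    qed
    moreover have "c (n * k + n) = l * c (Suc k)"
      using eig[of "Suc k"] by (simp add: algebra_simps)
    ultimately have "l * c (Suc k) * ?q = ?p * (l * c k)"
      using eig[OF k] by simp
    then have "c (Suc k) * ?q = ?p * c k"
      using \<open>l \<noteq> 0\<close> by simp
    then have "(c (Suc k) * poly Q (of_nat k)) * ?q = poly Q (of_nat k) * ?p * c k"
      by (simp add: mult_ac)
    then have "poly P (of_nat k) * ?q = poly Q (of_nat k) * ?p"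
      using rec[OF k] nz[OF k] by (simp add: P_def Q_def mult_ac)
    then show "poly (P * (\<Prod>i<n. sec Q i)) (of_nat k) = poly (Q * (\<Prod>i<n. sec P i)) (of_nat k)"
      by (simp add: poly_prod sec_def poly_pcompose algebra_simps)
  qed
  then have "order z (P * (\<Prod>i<n. sec Q i)) = order z (Q * (\<Prod>i<n. sec P i))"
    by simp
  then have "order z P + (\<Sum>i<n. order z (sec Q i)) = order z Q + (\<Sum>i<n. order z (sec P i))"
    using sec_nz by (subst (asm) (1 2) order_mult)
      (auto simp: order_prod_nonzero P_def Q_def)
  moreover have "order z P = count A z" "order z Q = count B z"
    using order_linear_factors_affine(2)[of 1 z _ 0] by (simp_all add: P_def Q_def pcompose_idR)
  moreover have "order z (sec P i) = count A (of_nat n * z + of_nat i)"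
                "order z (sec Q i) = count B (of_nat n * z + of_nat i)" for i
    using n by (simp_all add: sec_def P_def Q_def order_linear_factors_affine)
  ultimately have "count A z + (\<Sum>i<n. count B (of_nat n * z + of_nat i))
      = count B z + (\<Sum>i<n. count A (of_nat n * z + of_nat i))"
    by simp
  then have "int (count A z + (\<Sum>i<n. count B (of_nat n * z + of_nat i)))
      = int (count B z + (\<Sum>i<n. count A (of_nat n * z + of_nat i)))"
    by (rule arg_cong)
  then show ?thesis
    by (simp add: sum_subtractf)
qed

section \<open>The pole order of the associated Gamma quotient\<close>

definition mset_above :: "complex \<Rightarrow> complex multiset \<Rightarrow> complex multiset" where
  "mset_above z A = filter_mset (\<lambda>a. a - z \<in> \<nat>) A"

text \<open>Since \<open>Gamma (x - a)\<close> has its poles, all simple, where \<open>a - x\<close> is a natural number, and no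
  zeros, this is the order of the pole at \<open>z\<close> of
  \<open>(\<Prod>a\<in>A. Gamma (x - a)) / (\<Prod>b\<in>B. Gamma (x - b))\<close>.\<close>

definition excess :: "complex multiset \<Rightarrow> complex multiset \<Rightarrow> complex \<Rightarrow> int" where
  "excess A B z = int (size (mset_above z A)) - int (size (mset_above z B))"

lemma size_mset_above_step:
  "size (mset_above z A) = count A z + size (mset_above (z + 1) A)"
proof (induction A)
  case empty
  show ?case by (simp add: mset_above_def)
next
  case (add a A)
  have "a - z \<in> \<nat> \<longleftrightarrow> a = z \<or> a - (z + 1) \<in> \<nat>"
  proof
    assume "a - z \<in> \<nat>"
    then obtain k where k: "a - z = of_nat k" by (auto elim: Nats_cases)
    show "a = z \<or> a - (z + 1) \<in> \<nat>"
    proof (cases k)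
      case 0
      with k show ?thesis by simp
    next
      case (Suc i)
      with k have "a - (z + 1) = of_nat i" by (simp add: algebra_simps)
      then show ?thesis by simp
    qed
  next
    assume "a = z \<or> a - (z + 1) \<in> \<nat>"
    moreover have "a - z \<in> \<nat>" if "a - (z + 1) \<in> \<nat>"
      using Nats_add[OF that Nats_1] by (simp add: algebra_simps)
    ultimately show "a - z \<in> \<nat>" by auto
  qed
  moreover have "z - (z + 1) \<notin> \<nat>"
    by (simp add: Nats_def complex_eq_iff image_iff)
  ultimately show ?case
    using add by (auto simp: mset_above_def)
qed

lemma excess_diff: "excess A B z - excess A B (z + 1) = int (count A z) - int (count B z)"
  by (simp add: excess_def size_mset_above_step[of z])

lemma excess_diff_sum:
  "excess A B z - excess A B (z + of_nat N)
     = (\<Sum>i<N. int (count A (z + of_nat i)) - int (count B (z + of_nat i)))"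
proof (induction N)
  case (Suc N)
  then show ?case
    using excess_diff[of A B "z + of_nat N"] by (simp add: algebra_simps)
qed simp

lemma excess_nonzeroE:
  assumes "excess A B z \<noteq> 0"
  obtains a k where "a \<in># A + B" "z = a - of_nat k"
proof -
  have "mset_above z A \<noteq> {#} \<or> mset_above z B \<noteq> {#}"
    using assms by (auto simp: excess_def)
  then obtain a where "a \<in># A + B" "a - z \<in> \<nat>"
    by (auto simp: mset_above_def filter_mset_eq_mempty_iff)
  moreover from this obtain k where "a - z = of_nat k" by (auto elim: Nats_cases)
  then have "z = a - of_nat k" by (metis diff_diff_eq2 add_diff_cancel_left')
  ultimately show thesis by (intro that)
qed

lemma excess_eventually_zero:
  obtains x :: real where "\<And>z. Re z > x \<Longrightarrow> excess A B z = 0"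
proof -
  define x where "x = (\<Sum>a\<in>set_mset (A + B). \<bar>Re a\<bar>)"
  have "excess A B z = 0" if "Re z > x" for z
  proof (rule ccontr)
    assume "excess A B z \<noteq> 0"
    then obtain a k where a: "a \<in># A + B" "z = a - of_nat k"
      by (rule excess_nonzeroE)
    have "\<bar>Re a\<bar> \<le> x"
      unfolding x_def by (rule member_le_sum[OF a(1)]) auto
    with a that show False by auto
  qed
  then show thesis by (rule that)
qed

text \<open>Summing the unit steps of the excess from \<open>n z\<close> to \<open>n z + n\<close> turns the balance into
  the 1-periodicity of \<open>M (n z) - M z\<close>. Far to the right both terms vanish, hence everywhere.\<close>

lemma excess_scale:
  assumes n: "n \<ge> 1"
    and bal: "\<And>z. int (count A z) - int (count B z)
           = (\<Sum>i<n. int (count A (of_nat n * z + of_nat i)) - int (count B (of_nat n * z + of_nat i)))"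
  shows "excess A B (of_nat n * z) = excess A B z"
proof -
  define d where "d = (\<lambda>z. excess A B (of_nat n * z) - excess A B z)"
  have step: "d (z + 1) = d z" for z
    using bal[of z] excess_diff[of A B z] excess_diff_sum[of A B "of_nat n * z" n]
    by (simp add: d_def algebra_simps)
  have shift: "d (z + of_nat k) = d z" for k
    by (induction k) (use step in \<open>auto simp: add_ac\<close>, metis add.assoc add.commute)
  obtain x where x: "\<And>w. Re w > x \<Longrightarrow> excess A B w = 0"
    using excess_eventually_zero[of A B] by blast
  obtain k :: nat where k: "\<bar>x\<bar> - Re z < real k"
    using reals_Archimedean2 by blast
  define w where "w = z + of_nat k"
  have "Re w > \<bar>x\<bar>" using k by (simp add: w_def)
  moreover from this have "1 * Re w \<le> real n * Re w"
    using n by (intro mult_right_mono) auto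
  ultimately have "d w = 0"
    by (simp add: d_def x)
  then have "d z = 0"
    using shift by (simp add: w_def)
  then show ?thesis by (simp add: d_def)
qed

text \<open>Invariance under \<open>z \<mapsto> n z\<close> also gives invariance under \<open>z \<mapsto> z / n\<close>. The points
  \<open>z / n\<^sup>i\<close> are infinitely many in a disc around 0, but the excess is non-zero only on
  finitely many leftward progressions \<open>a, a - 1, a - 2, \<dots>\<close>, each of which meets the disc in a
  finite set.\<close>

lemma excess_zero_away_from_0:
  assumes n: "n \<ge> 2"
    and scale: "\<And>z. excess A B (of_nat n * z) = excess A B z"
    and "z \<noteq> 0"
  shows "excess A B z = 0"
proof (rule ccontr)
  assume ne: "excess A B z \<noteq> 0"
  define w where "w = (\<lambda>i::nat. z / of_nat n ^ i)"
  define S where "S = {v. excess A B v \<noteq> 0 \<and> norm v \<le> norm z}"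
  have "excess A B (w i) = excess A B z" for i
  proof (induction i)
    case (Suc i)
    have "of_nat n * w (Suc i) = w i" using n by (simp add: w_def)
    with Suc scale[of "w (Suc i)"] show ?case by simp
  qed (simp add: w_def)
  moreover have "norm (w i) \<le> norm z" for i
  proof -
    have "1 \<le> real n ^ i" using n by simp
    then have "norm z / real n ^ i \<le> norm z / 1"
      using n by (intro divide_left_mono) auto
    then show ?thesis by (simp add: w_def norm_divide norm_power)
  qed
  ultimately have "range w \<subseteq> S"
    using ne by (auto simp: S_def)
  moreover have "finite S"
  proof (rule finite_subset)
    show "S \<subseteq> (\<Union>a\<in>set_mset (A + B). (\<lambda>k. a - of_nat k) ` {..nat \<lceil>norm a + norm z\<rceil>})"
    proof
      fix v assume "v \<in> S"
      then obtain a k where ak: "a \<in># A + B" "v = a - of_nat k" "norm v \<le> norm z"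
        by (auto simp: S_def elim: excess_nonzeroE)
      have "real k = norm (a - v)" using ak by simp
      also have "\<dots> \<le> norm a + norm z"
        using norm_triangle_ineq4[of a v] ak by simp
      finally have "k \<le> nat \<lceil>norm a + norm z\<rceil>" by linarith
      with ak show "v \<in> (\<Union>a\<in>set_mset (A + B). (\<lambda>k. a - of_nat k) ` {..nat \<lceil>norm a + norm z\<rceil>})"
        by blast
    qed
  qed auto
  ultimately have "finite (range w)" by (rule finite_subset)
  moreover have "inj w"
  proof (rule injI)
    fix i j assume "w i = w j"
    then have "(of_nat (n ^ i) :: complex) = of_nat (n ^ j)"
      using \<open>z \<noteq> 0\<close> n by (simp add: w_def field_simps)
    then have "n ^ i = n ^ j" by (simp only: of_nat_eq_iff)
    then show "i = j" using n by simp
  qed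
  ultimately show False
    using finite_imageD infinite_UNIV_nat by blast
qed

text \<open>The multiplicity of \<open>z\<close> in \<open>A\<close> minus that in \<open>B\<close> is \<open>M z - M (z + 1)\<close>. If \<open>M\<close> is
  concentrated at 0 with value \<open>i\<close>, then all roots cancel except for \<open>i\<close> zeros at 0 and
  \<open>i\<close> poles at \<open>-1\<close>.\<close>

lemma ratio_of_excess_supported_at_0:
  fixes x :: complex
  assumes supp: "\<And>z. z \<noteq> 0 \<Longrightarrow> excess A B z = 0"
    and x: "x \<noteq> 0" "x \<noteq> -1"
  shows "poly (linear_factors A) x * (x + 1) powi (excess A B 0)
           = poly (linear_factors B) x * x powi (excess A B 0)"
proof -
  define i where "i = excess A B 0"
  have cnt: "int (count A z) - int (count B z) = (if z = 0 then i else if z = -1 then -i else 0)" for z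
  proof -
    consider "z = 0" | "z = -1" | "z \<noteq> 0" "z \<noteq> -1" "z + 1 \<noteq> 0"
      by (auto simp: add_eq_0_iff2)
    then show ?thesis
      using excess_diff[of A B z] supp[of z] supp[of "z + 1"] by cases (auto simp: i_def)
  qed
  \<comment> \<open>One of \<open>nat i\<close> and \<open>nat (-i)\<close> is 0; this form treats both signs at once.\<close>
  have "A + replicate_mset (nat (-i)) 0 + replicate_mset (nat i) (-1)
      = B + replicate_mset (nat i) 0 + replicate_mset (nat (-i)) (-1)"
  proof (rule multiset_eqI)
    fix z
    show "count (A + replicate_mset (nat (-i)) 0 + replicate_mset (nat i) (-1)) z
      = count (B + replicate_mset (nat i) 0 + replicate_mset (nat (-i)) (-1)) z"
      using cnt[of z] by (auto split: if_splits)
  qed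
  then have "(\<Prod>a\<in>#A + replicate_mset (nat (-i)) 0 + replicate_mset (nat i) (-1). x - a)
      = (\<Prod>a\<in>#B + replicate_mset (nat i) 0 + replicate_mset (nat (-i)) (-1). x - a)"
    by (rule arg_cong)
  then have eq: "poly (linear_factors A) x * x ^ nat (-i) * (x + 1) ^ nat i
      = poly (linear_factors B) x * x ^ nat i * (x + 1) ^ nat (-i)"
    by (simp add: poly_linear_factors)
  have "x + 1 \<noteq> 0" using x by (simp add: add_eq_0_iff2)
  with eq x show ?thesis
    unfolding i_def[symmetric]
    by (cases "i \<ge> 0") (auto simp: power_int_def field_simps)
qed

text \<open>The ratio being \<open>(k / (k + 1))\<^sup>i\<close>, the product \<open>c k k\<^sup>i\<close> is constant; its values
  at 1 and at \<open>n\<close> determine the eigenvalue.\<close>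

lemma eigenvalue_of_rational_ratio:
  fixes c :: "nat \<Rightarrow> complex"
  assumes n: "n \<ge> 2"
    and rec: "\<And>k. k \<ge> 1 \<Longrightarrow> c (Suc k) * poly (linear_factors B) (of_nat k)
                       = poly (linear_factors A) (of_nat k) * c k"
    and nz: "\<And>k. k \<ge> 1 \<Longrightarrow> c k \<noteq> 0"
    and Bnz: "\<And>k. k \<ge> 1 \<Longrightarrow> poly (linear_factors B) (of_nat k) \<noteq> 0"
    and eig: "\<And>k. k \<ge> 1 \<Longrightarrow> c (n * k) = l * c k"
  shows "\<exists>i::int. l = of_nat n powi i"
proof -
  define i where "i = excess A B 0"
  have "excess A B (of_nat n * z) = excess A B z" for z
    by (rule excess_scale) (use n in simp, rule root_multiplicities_balance[OF _ rec nz eig], use n in simp)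
  then have supp: "excess A B z = 0" if "z \<noteq> 0" for z
    using excess_zero_away_from_0[OF n _ that] by simp
  have const: "c (Suc k) * of_nat (Suc k) powi i = c 1" for k
  proof (induction k)
    case (Suc k)
    let ?x = "of_nat (Suc k) :: complex"
    let ?P = "poly (linear_factors A) ?x" and ?Q = "poly (linear_factors B) ?x"
    have x: "?x \<noteq> 0" "?x \<noteq> -1"
    proof -
      have "Re ?x \<noteq> Re 0" "Re ?x \<noteq> Re (-1)" by auto
      then show "?x \<noteq> 0" "?x \<noteq> -1" by metis+
    qed
    have "?Q * (c (Suc (Suc k)) * (?x + 1) powi i) = (c (Suc (Suc k)) * ?Q) * (?x + 1) powi i"
      by (simp add: mult_ac)
    also have "\<dots> = c (Suc k) * (?P * (?x + 1) powi i)"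
      using rec[of "Suc k"] by (simp add: mult_ac)
    also have "\<dots> = ?Q * (c (Suc k) * ?x powi i)"
      using ratio_of_excess_supported_at_0[OF supp x] by (simp add: i_def mult_ac)
    finally have "c (Suc (Suc k)) * (?x + 1) powi i = c (Suc k) * ?x powi i"
      using Bnz[of "Suc k"] by (simp del: of_nat_Suc)
    with Suc show ?case by (simp add: add_ac)
  qed simp
  have "l * c 1 * of_nat n powi i = c 1"
    using eig[of 1] const[of "n - 1"] n by simp
  then have "l * of_nat n powi i = 1"
    using nz[of 1] by (simp add: mult_ac)
  then have "l = of_nat n powi (- i)"
    using n by (auto simp: power_int_minus field_simps)
  then show ?thesis ..
qed

section \<open>Coefficients of hypergeometric series\<close>

lemma fps_hypergeo_nth_mset:
  fixes as bs :: "complex list"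
  shows "fps_hypergeo as bs 1 $ k
     = (\<Prod>a\<in>#mset as. pochhammer a k) / ((\<Prod>b\<in>#mset bs. pochhammer b k) * fact k)"
proof -
  have "foldl (\<lambda>r a. r * pochhammer a k) s xs = s * (\<Prod>a\<in>#mset xs. pochhammer a k)" for s and xs :: "complex list"
    by (induction xs arbitrary: s) (auto simp: mult_ac)
  then show ?thesis unfolding fps_hypergeo_nth by simp
qed

lemma fps_hypergeo_nth_Suc:
  fixes as bs :: "complex list"
  assumes "set bs \<inter> \<int>\<^sub>\<le>\<^sub>0 = {}"
  shows "(\<Prod>b\<in>#mset bs. b + of_nat k) \<noteq> (0 :: complex)"
    and "fps_hypergeo as bs 1 $ Suc k * (of_nat (Suc k) * (\<Prod>b\<in>#mset bs. b + of_nat k))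
           = (\<Prod>a\<in>#mset as. a + of_nat k) * fps_hypergeo as bs 1 $ k"
proof -
  have b: "b + of_nat k \<noteq> 0" "pochhammer b k \<noteq> 0" if "b \<in> set bs" for b k
  proof -
    have "b \<notin> \<int>\<^sub>\<le>\<^sub>0" using that assms by auto
    then show "b + of_nat k \<noteq> 0" "pochhammer b k \<noteq> 0"
      by (auto simp: add_eq_0_iff2 pochhammer_eq_0_iff)
  qed
  then show 1: "(\<Prod>b\<in>#mset bs. b + of_nat k) \<noteq> (0 :: complex)"
    by auto
  have 2: "(\<Prod>b\<in>#mset bs. pochhammer b k) \<noteq> (0 :: complex)"
    using b by auto
  have 3: "1 + of_nat k \<noteq> (0::complex)"
    by (metis of_nat_Suc of_nat_neq_0)
  show "fps_hypergeo as bs 1 $ Suc k * (of_nat (Suc k) * (\<Prod>b\<in>#mset bs. b + of_nat k))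
           = (\<Prod>a\<in>#mset as. a + of_nat k) * fps_hypergeo as bs 1 $ k"
    unfolding fps_hypergeo_nth_mset pochhammer_Suc prod_mset.distrib fact_Suc
    using 1 2 3 by (simp add: divide_simps)
qed

lemma fps_hypergeo_zero_persists:
  fixes as bs :: "complex list"
  assumes "set bs \<inter> \<int>\<^sub>\<le>\<^sub>0 = {}" "fps_hypergeo as bs 1 $ k = 0" "k \<le> m"
  shows "fps_hypergeo as bs 1 $ m = 0"
  using assms(3)
proof (induction m rule: dec_induct)
  case (step m)
  then show ?case
    using fps_hypergeo_nth_Suc(1)[OF assms(1), of m] fps_hypergeo_nth_Suc(2)[OF assms(1), of as m]
    by (simp del: fps_hypergeo_nth of_nat_Suc)
qed (fact assms(2))

section \<open>Eigenvalues of hypergeometric eigenfunctions\<close>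

text \<open>Exponents of the form \<open>n\<^sup>t j\<close> and \<open>n\<^sup>t\<close>, along which the coefficients of an
  eigenfunction are multiplied by powers of \<open>l\<close>, leave only the leading exponents 0 and 1. The first gives
  \<open>l = 1\<close>, the second is the situation of \<open>eigenvalue_of_rational_ratio\<close>.\<close>

lemma hypergeometric_nonzero_eigenvalue:
  assumes n: "n \<ge> 2"
    and f: "f \<in> hypergeometric_functions"
    and eig: "hecke_U n f = fps_const l * f"
    and "l \<noteq> 0"
  shows "\<exists>i::int. l = of_nat n powi i"
proof -
  obtain j as bs where f_eq: "f = fps_X ^ j * fps_hypergeo as bs 1" and bs: "set bs \<inter> \<int>\<^sub>\<le>\<^sub>0 = {}"
    using f by (auto simp: hypergeometric_functions_def)
  have f_nth: "f $ k = (if k < j then 0 else fps_hypergeo as bs 1 $ (k - j))" for k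
    by (simp add: f_eq fps_X_power_mult_nth)
  have step: "f $ (n * k) = l * f $ k" for k
    using arg_cong[OF eig, of "\<lambda>g. g $ k"] by (simp add: hecke_U_def)
  have pow: "f $ (n ^ t * k) = l ^ t * f $ k" for t k
  proof (induction t)
    case (Suc t)
    then show ?case using step[of "n ^ t * k"] by (simp add: mult_ac)
  qed simp
  have fj: "f $ j = 1"
    by (simp add: f_nth del: fps_hypergeo_nth)
  show ?thesis
  proof (cases "j = 0")
    case True
    then have "l = 1" using step[of 0] fj by simp
    then show ?thesis by (intro exI[of _ 0]) simp
  next
    case False
    have large: "\<exists>t. k \<le> n ^ t" for k
      using n by (meson less_exp less_or_eq_imp_le order_trans power_mono zero_le_numeral)
    \<comment> \<open>The coefficients at the exponents \<open>n\<^sup>t j\<close> are powers of \<open>l \<noteq> 0\<close>, and these exponents are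
      unbounded; so the series cannot terminate.\<close>
    have nonzero: "fps_hypergeo as bs 1 $ k \<noteq> 0" for k
    proof
      assume 0: "fps_hypergeo as bs 1 $ k = 0"
      obtain t where t: "j + k \<le> n ^ t" using large by blast
      have "n ^ t \<le> n ^ t * j" using False by simp
      with t have "j + k \<le> n ^ t * j" by linarith
      then have "f $ (n ^ t * j) = 0"
        using fps_hypergeo_zero_persists[OF bs 0, of "n ^ t * j - j"]
        by (simp add: f_nth del: fps_hypergeo_nth)
      then show False using pow[of t j] fj \<open>l \<noteq> 0\<close> by simp
    qed
    obtain t where "j \<le> n ^ t" using large by blast
    then have "f $ (n ^ t) \<noteq> 0"
      using nonzero by (simp add: f_nth del: fps_hypergeo_nth)
    then have "f $ 1 \<noteq> 0" using pow[of t 1] by auto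
    then have j: "j = 1" using False by (auto simp: f_nth split: if_splits)
    \<comment> \<open>As \<open>j = 1\<close>, the coefficient of \<open>f\<close> at \<open>k\<close> is that of the hypergeometric series at
      \<open>k - 1\<close>: the factors of its ratio are \<open>a + k - 1\<close> and \<open>b + k - 1\<close>, and \<open>k\<close> from
      the factorial, which is the root 0 of \<open>B\<close>.\<close>
    define A where "A = image_mset (\<lambda>a. 1 - a) (mset as)"
    define B where "B = add_mset 0 (image_mset (\<lambda>b. 1 - b) (mset bs))"
    have at: "poly (linear_factors A) (of_nat (Suc k)) = (\<Prod>a\<in>#mset as. a + of_nat k)"
             "poly (linear_factors B) (of_nat (Suc k)) = of_nat (Suc k) * (\<Prod>b\<in>#mset bs. b + of_nat k)"
      for k
      by (simp_all add: A_def B_def poly_linear_factors image_mset.compositionality o_def algebra_simps)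
    show ?thesis
    proof (rule eigenvalue_of_rational_ratio[OF n, of "fps_nth f" B A])
      fix k :: nat assume "k \<ge> 1"
      then obtain m where k: "k = Suc m" by (cases k) auto
      show "f $ Suc k * poly (linear_factors B) (of_nat k) = poly (linear_factors A) (of_nat k) * f $ k"
        using fps_hypergeo_nth_Suc(2)[OF bs, of as m]
        unfolding k at by (simp add: f_nth j del: fps_hypergeo_nth of_nat_Suc)
      show "f $ k \<noteq> 0" using nonzero by (simp add: f_nth j k del: fps_hypergeo_nth)
      show "poly (linear_factors B) (of_nat k) \<noteq> 0"
        unfolding k at using fps_hypergeo_nth_Suc(1)[OF bs, of m] by (simp del: of_nat_Suc)
      show "f $ (n * k) = l * f $ k" by (rule step)
    qed
  qed
qed

text \<open>If \<open>l = 0\<close>, then the coefficient at \<open>n j\<close> vanishes. It lies at or beyond the leading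
  exponent \<open>j\<close>, so it terminates the series.\<close>

lemma nonterminating_eigenvalue_nonzero:
  assumes n: "n \<ge> 1"
    and f: "f \<in> nonterminating_hypergeometric_functions"
    and eig: "hecke_U n f = fps_const l * f"
  shows "l \<noteq> 0"
proof
  assume "l = 0"
  obtain j as bs where f_eq: "f = fps_X ^ j * fps_hypergeo as bs 1" and bs: "set bs \<inter> \<int>\<^sub>\<le>\<^sub>0 = {}"
    and inf: "infinite {k. f $ k \<noteq> 0}"
    using f by (auto simp: nonterminating_hypergeometric_functions_def hypergeometric_functions_def)
  have f_nth: "f $ k = (if k < j then 0 else fps_hypergeo as bs 1 $ (k - j))" for k
    by (simp add: f_eq fps_X_power_mult_nth)
  have "f $ (n * j) = 0"
    using arg_cong[OF eig, of "\<lambda>g. g $ j"] \<open>l = 0\<close> by (simp add: hecke_U_def)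
  moreover have "j \<le> n * j" using n by simp
  ultimately have start: "fps_hypergeo as bs 1 $ (n * j - j) = 0"
    using f_nth[of "n * j"] by (metis not_less)
  have "f $ k = 0" if "n * j \<le> k" for k
    using fps_hypergeo_zero_persists[OF bs start, of "k - j"] that
    by (simp add: f_nth diff_le_mono del: fps_hypergeo_nth)
  then have "{k. f $ k \<noteq> 0} \<subseteq> {..<n * j}"
    by (auto simp: not_less[symmetric])
  then show False
    using inf finite_subset by blast
qed

section \<open>Eigenfunctions for all integer powers\<close>

definition power_series_of_powers :: "int \<Rightarrow> complex fps" where
  "power_series_of_powers i = Abs_fps (\<lambda>k. if k = 0 then 0 else of_nat k powi i)"

lemma pochhammer_2: "pochhammer 2 k = (of_nat (Suc k) * fact k :: complex)"
  using pochhammer_rec[of "1::complex" k] by (simp flip: pochhammer_fact)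

text \<open>After the factor \<open>x\<close> is split off, the coefficients are
  \<open>(k + 1)\<^sup>i = ((2)\<^sub>k / (1)\<^sub>k)\<^sup>i\<close>. The additional numerator parameter 1 cancels the
  factorial in the hypergeometric series.\<close>

lemma power_series_of_powers_nonterminating:
  "power_series_of_powers i \<in> nonterminating_hypergeometric_functions"
proof -
  define m where "m = nat \<bar>i\<bar>"
  define as :: "complex list" where "as = (if i \<ge> 0 then 1 # replicate m 2 else 1 # replicate m 1)"
  define bs :: "complex list" where "bs = (if i \<ge> 0 then replicate m 1 else replicate m 2)"
  have "(1::complex) \<notin> \<int>\<^sub>\<le>\<^sub>0" "(2::complex) \<notin> \<int>\<^sub>\<le>\<^sub>0" by auto
  then have bs: "set bs \<inter> \<int>\<^sub>\<le>\<^sub>0 = {}" by (auto simp: bs_def)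
  have "fps_hypergeo as bs 1 $ k = of_nat (Suc k) powi i" for k
    by (simp add: fps_hypergeo_nth_mset as_def bs_def m_def pochhammer_2 pochhammer_fact[symmetric]
          power_int_def power_mult_distrib field_simps
          del: of_nat_Suc fps_hypergeo_nth)
  then have "power_series_of_powers i = fps_X ^ 1 * fps_hypergeo as bs 1"
    by (intro fps_ext) (auto simp: power_series_of_powers_def simp del: fps_hypergeo_nth of_nat_Suc)
  with bs have "power_series_of_powers i \<in> hypergeometric_functions"
    unfolding hypergeometric_functions_def by blast
  moreover have "{k. power_series_of_powers i $ k \<noteq> 0} = {1..}"
    by (auto simp: power_series_of_powers_def)
  ultimately show ?thesis
    using infinite_Ici[of "1::nat"] by (simp add: nonterminating_hypergeometric_functions_def)
qed

lemma hecke_U_power_series_of_powers: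
  assumes "n \<ge> 1"
  shows "hecke_U n (power_series_of_powers i)
           = fps_const (of_nat n powi i) * power_series_of_powers i"
  using assms by (intro fps_ext) (auto simp: hecke_U_def power_series_of_powers_def power_int_mult_distrib)

section \<open>The spectrum\<close>

theorem theorem6p15:
  fixes n :: nat
  assumes "n \<ge> 1"
  shows "spectrum_on (hecke_U n) nonterminating_hypergeometric_functions
           = {of_nat n powi i | i :: int. True}
       \<and> spectrum_on (hecke_U n) hypergeometric_functions
           = {of_nat n powi i | i :: int. True} \<union> (if n = 1 then {} else {0})"
proof -
  let ?N = nonterminating_hypergeometric_functions and ?H = hypergeometric_functions
  let ?S = "{of_nat n powi i | i :: int. True} :: complex set"
  have "?N \<subseteq> ?H"
    by (auto simp: nonterminating_hypergeometric_functions_def)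
  then have mono: "spectrum_on (hecke_U n) ?N \<subseteq> spectrum_on (hecke_U n) ?H"
    by (auto simp: spectrum_on_def)
  have powers: "?S \<subseteq> spectrum_on (hecke_U n) ?N"
  proof clarify
    fix i :: int
    have "power_series_of_powers i \<noteq> 0"
      by (auto simp: power_series_of_powers_def fps_eq_iff intro!: exI[of _ 1])
    then show "of_nat n powi i \<in> spectrum_on (hecke_U n) ?N"
      unfolding spectrum_on_def
      using power_series_of_powers_nonterminating hecke_U_power_series_of_powers[OF assms] by blast
  qed
  have nonzero: "l \<in> ?S" if "l \<in> spectrum_on (hecke_U n) ?H" "l \<noteq> 0 \<or> n = 1" for l
  proof (cases "n = 1")
    case True
    from that obtain f where "f \<noteq> 0" "hecke_U n f = fps_const l * f"
      by (auto simp: spectrum_on_def)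
    moreover from True have "hecke_U n f = fps_const 1 * f"
      by (simp add: hecke_U_def fps_eq_iff)
    ultimately have "fps_const l = fps_const 1"
      by (metis mult_right_cancel)
    then have "l = 1"
      by (metis fps_nth_fps_const)
    then show ?thesis
      by (auto intro!: exI[of _ 0])
  next
    case False
    with that assms hypergeometric_nonzero_eigenvalue[of n _ l] show ?thesis
      by (auto simp: spectrum_on_def)
  qed
  have "spectrum_on (hecke_U n) ?N = ?S"
  proof
    show "spectrum_on (hecke_U n) ?N \<subseteq> ?S"
    proof
      fix l assume l: "l \<in> spectrum_on (hecke_U n) ?N"
      then have "l \<noteq> 0"
        using nonterminating_eigenvalue_nonzero[OF assms] by (auto simp: spectrum_on_def)
      with l mono nonzero show "l \<in> ?S" by blast
    qed
  qed (fact powers)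
  moreover have "spectrum_on (hecke_U n) ?H = ?S \<union> (if n = 1 then {} else {0})"
  proof
    show "spectrum_on (hecke_U n) ?H \<subseteq> ?S \<union> (if n = 1 then {} else {0})"
      using nonzero by auto
    show "?S \<union> (if n = 1 then {} else {0}) \<subseteq> spectrum_on (hecke_U n) ?H"
      using powers mono zero_in_spectrum_hecke_U[of n] assms by (auto split: if_splits)
  qed
  ultimately show ?thesis by blast
qed

end
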